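(* Let $G\in\mathcal{G}^{\rm SSP}$ be a nonempty graph. Then the join $G\vee H$ belongs to $\mathcal{G}^{\rm SSP}$ whenever the graph $H$ satisfies one of the following: (a) $H\in\mathcal{G}^{\rm SSP}$; (b) the complement $H^c$ is a disjoint union of trees and unicyclic graphs whose cycles have odd length.
   Context: All graphs are finite, simple, undirected. The join $G\vee H$ is the disjoint union of $G$ and $H$ together with all edges joining a vertex of $G$ to a vertex of $H$. A unicyclic graph is a connected graph with exactly one cycle. For a graph $G$ on $\{1,\ldots,n\}$, $\mathcal{S}(G)$ is the set of real symmetric $n\times n$ matrices $A=(a_{ij})$ with $a_{ij}\neq0$ iff $\{i,j\}\in E(G)$ for $i\neq j$ (diagonal arbitrary). A real symmetric $A$ has the strong spectral property (SSP) if the only real symmetric $X$ with $A\circ X=0$, $I\circ X=0$, $AX-XA=0$ is $X=0$ ($\circ$ = entrywise product). $\mathcal{G}^{\rm SSP}$ is the set of graphs $G$ such that every matrix in $\mathcal{S}(G)$ has the SSP. *)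

theory Defs
  imports "HOL-Analysis.Analysis"
begin

definition sgraph :: "('v \<Rightarrow> 'v \<Rightarrow> bool) \<Rightarrow> bool" where
  "sgraph E \<longleftrightarrow> (\<forall>x y. E x y \<longrightarrow> E y x) \<and> (\<forall>x. \<not> E x x)"

definition S_graph :: "('n::finite \<Rightarrow> 'n \<Rightarrow> bool) \<Rightarrow> (real^'n^'n) set" where
  "S_graph E = {A. transpose A = A \<and>
                   (\<forall>i j. i \<noteq> j \<longrightarrow> (A $ i $ j \<noteq> 0 \<longleftrightarrow> E i j))}"

definition SSP :: "real^'n^'n \<Rightarrow> bool" where
  "SSP A \<longleftrightarrow> (\<forall>X :: real^'n^'n.
      transpose X = X \<and> (\<forall>i j. A $ i $ j * X $ i $ j = 0) \<and> (\<forall>i. X $ i $ i = 0)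
      \<and> A ** X - X ** A = 0 \<longrightarrow> X = 0)"

definition GSSP :: "('n::finite \<Rightarrow> 'n \<Rightarrow> bool) \<Rightarrow> bool" where
  "GSSP E \<longleftrightarrow> (\<forall>A \<in> S_graph E. SSP A)"

fun graph_join :: "('a \<Rightarrow> 'a \<Rightarrow> bool) \<Rightarrow> ('b \<Rightarrow> 'b \<Rightarrow> bool) \<Rightarrow> 'a + 'b \<Rightarrow> 'a + 'b \<Rightarrow> bool" where
  "graph_join G H (Inl x) (Inl y) = G x y"
| "graph_join G H (Inr x) (Inr y) = H x y"
| "graph_join G H (Inl x) (Inr y) = True"
| "graph_join G H (Inr x) (Inl y) = True"

definition graph_complement :: "('v \<Rightarrow> 'v \<Rightarrow> bool) \<Rightarrow> 'v \<Rightarrow> 'v \<Rightarrow> bool" where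
  "graph_complement E x y \<longleftrightarrow> x \<noteq> y \<and> \<not> E x y"

text \<open>Cycles, given by a cyclic list of distinct vertices of length at least 3;
the cycle as a subgraph is identified by its edge set.\<close>

definition is_cycle :: "('v \<Rightarrow> 'v \<Rightarrow> bool) \<Rightarrow> 'v list \<Rightarrow> bool" where
  "is_cycle E cs \<longleftrightarrow> length cs \<ge> 3 \<and> distinct cs \<and>
     (\<forall>i < length cs. E (cs ! i) (cs ! ((i + 1) mod length cs)))"

definition cycle_edges :: "'v list \<Rightarrow> 'v set set" where
  "cycle_edges cs = {{cs ! i, cs ! ((i + 1) mod length cs)} | i. i < length cs}"

definition component :: "('v \<Rightarrow> 'v \<Rightarrow> bool) \<Rightarrow> 'v \<Rightarrow> 'v set" where
  "component E x = {y. E\<^sup>*\<^sup>* x y}"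

definition tree_component :: "('v \<Rightarrow> 'v \<Rightarrow> bool) \<Rightarrow> 'v set \<Rightarrow> bool" where
  "tree_component E C \<longleftrightarrow> \<not> (\<exists>cs. is_cycle E cs \<and> set cs \<subseteq> C)"

definition odd_unicyclic_component :: "('v \<Rightarrow> 'v \<Rightarrow> bool) \<Rightarrow> 'v set \<Rightarrow> bool" where
  "odd_unicyclic_component E C \<longleftrightarrow>
     (\<exists>!S. \<exists>cs. is_cycle E cs \<and> set cs \<subseteq> C \<and> cycle_edges cs = S) \<and>
     (\<forall>cs. is_cycle E cs \<and> set cs \<subseteq> C \<longrightarrow> odd (length cs))"

definition trees_odd_unicyclic :: "('v \<Rightarrow> 'v \<Rightarrow> bool) \<Rightarrow> bool" where
  "trees_odd_unicyclic E \<longleftrightarrow>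
     (\<forall>x. tree_component E (component E x) \<or> odd_unicyclic_component E (component E x))"

end

theory Submission
  imports Defs
begin

text \<open>If X satisfies the SSP equations for A in S(G \<or> H), it vanishes on every pair joining
  G to H, since all of these are edges. Its G-block then satisfies the SSP equations for the
  G-block of A and vanishes; in case (a) the same holds for the H-block. In case (b), commuting
  with A at a row indexed by G shows that the nowhere zero row w of the G-H block of A is a left
  null vector of the H-block X', so w i * X' i j * w j is a symmetric weighting with zero row sums
  supported on the edges of the complement of H. Such a weighting is zero: in its support, the
  last vertex of a longest path has a second neighbour, which lies on the path and closes a
  cycle. This is impossible in a tree; in an odd-unicyclic component it forces the support to be
  the odd cycle, along which the weights would have to alternate in sign.\<close>

section \<open>Paths and cycles\<close>

definition is_path :: "('v \<Rightarrow> 'v \<Rightarrow> bool) \<Rightarrow> 'v list \<Rightarrow> bool" where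
  "is_path K P \<longleftrightarrow> distinct P \<and> 2 \<le> length P \<and> successively K P"

definition longest_path :: "('v::finite \<Rightarrow> 'v \<Rightarrow> bool) \<Rightarrow> 'v list \<Rightarrow> bool" where
  "longest_path K P \<longleftrightarrow> is_path K P \<and> (\<forall>Q. is_path K Q \<longrightarrow> length Q \<le> length P)"

lemma longest_path_exists:
  fixes K :: "'v::finite \<Rightarrow> 'v \<Rightarrow> bool"
  assumes "is_path K P"
  obtains Q where "longest_path K Q"
proof -
  let ?paths = "{Q. is_path K Q}"
  have "?paths \<subseteq> {xs. set xs \<subseteq> UNIV \<and> distinct xs}"
    unfolding is_path_def by blast
  moreover have "finite {xs. set xs \<subseteq> (UNIV :: 'v set) \<and> distinct xs}"
    by (rule finite_subset_distinct) simp
  ultimately have fin: "finite (length ` ?paths)"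
    using finite_subset by blast
  have "Max (length ` ?paths) \<in> length ` ?paths"
    using assms by (intro Max_in fin) auto
  then obtain Q where Q: "is_path K Q" "length Q = Max (length ` ?paths)"
    by auto
  have "length Q' \<le> length Q" if "is_path K Q'" for Q'
    using that Q(2) by (simp add: Max_ge fin)
  with Q(1) show ?thesis
    using that unfolding longest_path_def by blast
qed

lemma is_path_rev:
  assumes "is_path K P" and "\<And>x y. K x y \<Longrightarrow> K y x"
  shows "is_path K (rev P)"
  using assms by (auto simp: is_path_def intro: successively_mono)

lemma longest_path_rev:
  assumes "longest_path K P" and "\<And>x y. K x y \<Longrightarrow> K y x"
  shows "longest_path K (rev P)"
  using assms is_path_rev by (fastforce simp: longest_path_def)

lemma is_path_last_adj:
  assumes "is_path K P"
  shows "K (P ! (length P - 2)) (last P)"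
proof -
  have n: "2 \<le> length P"
    using assms by (simp add: is_path_def)
  then have "last P = P ! Suc (length P - 2)"
    by (cases P) (auto simp: last_conv_nth Suc_diff_Suc)
  with n show ?thesis
    using assms successively_nth[of K P "length P - 2"] by (simp add: is_path_def)
qed

lemma is_path_rotate1:
  assumes "is_path K P" and "K (last P) (hd P)"
  shows "is_path K (rotate1 P)"
proof -
  have "2 \<le> length P"
    using assms(1) by (simp add: is_path_def)
  then obtain u v Q where P: "P = u # v # Q"
    by (metis Suc_le_length_iff numeral_2_eq_2)
  have "successively K ((v # Q) @ [u])"
    unfolding successively_append_iff using assms P by (auto simp: is_path_def)
  with assms(1) P show ?thesis
    by (auto simp: is_path_def)
qed

lemma is_cycle_mono:
  assumes "is_cycle K cs" and "\<And>x y. K x y \<Longrightarrow> F x y"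
  shows "is_cycle F cs"
  using assms by (simp add: is_cycle_def)

lemma Union_cycle_edges:
  assumes "cs \<noteq> []"
  shows "\<Union> (cycle_edges cs) = set cs"
proof
  show "\<Union> (cycle_edges cs) \<subseteq> set cs"
    using assms by (auto simp: cycle_edges_def)
  show "set cs \<subseteq> \<Union> (cycle_edges cs)"
  proof
    fix x
    assume "x \<in> set cs"
    then obtain i where i: "i < length cs" "x = cs ! i"
      by (auto simp: in_set_conv_nth)
    then have "{cs ! i, cs ! ((i + 1) mod length cs)} \<in> cycle_edges cs"
      unfolding cycle_edges_def by blast
    with i show "x \<in> \<Union> (cycle_edges cs)"
      by blast
  qed
qed

lemma successively_rtranclp:
  "successively K xs \<Longrightarrow> x \<in> set xs \<Longrightarrow> K\<^sup>*\<^sup>* (hd xs) x"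
proof (induction xs)
  case (Cons u xs)
  then show ?case
    by (cases xs) (auto simp: successively_Cons intro: converse_rtranclp_into_rtranclp)
qed simp

lemma longest_path_last_cycle:
  assumes longest: "longest_path K P" and irrefl: "\<And>x. \<not> K x x"
    and j: "K (last P) j" "j \<noteq> P ! (length P - 2)"
  obtains m where "m + 3 \<le> length P" "j = P ! m" "is_cycle K (drop m P)"
proof -
  let ?n = "length P"
  have path: "is_path K P"
    using longest by (simp add: longest_path_def)
  then have n: "2 \<le> ?n" and "distinct P" and "successively K P"
    by (auto simp: is_path_def)
  have last_nth: "last P = P ! (?n - 1)"
    using n by (cases P) (auto simp: last_conv_nth)
  have "j \<in> set P"
  proof (rule ccontr)
    assume "j \<notin> set P"
    then have "is_path K (P @ [j])"
      using path j(1) by (auto simp: is_path_def successively_append_iff)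
    then show False
      using longest by (auto simp: longest_path_def)
  qed
  then obtain m where m: "m < ?n" "j = P ! m"
    by (auto simp: in_set_conv_nth)
  have "m \<noteq> ?n - 1"
    using j(1) m irrefl last_nth by auto
  with m j(2) n have m3: "m + 3 \<le> ?n"
    by (cases "m = ?n - 2") auto
  have "is_cycle K (drop m P)"
    unfolding is_cycle_def
  proof (intro conjI allI impI)
    show "3 \<le> length (drop m P)" and "distinct (drop m P)"
      using m3 \<open>distinct P\<close> by auto
    fix i
    assume i: "i < length (drop m P)"
    show "K (drop m P ! i) (drop m P ! ((i + 1) mod length (drop m P)))"
    proof (cases "i + 1 < length (drop m P)")
      case True
      then show ?thesis
        using successively_nth[OF \<open>successively K P\<close>, of "m + i"] by simp
    next
      case False
      then have "i + 1 = length (drop m P)"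
        using i by simp
      then have "m + i = ?n - 1" and "(i + 1) mod length (drop m P) = 0"
        by auto
      then show ?thesis
        using j(1) m m3 last_nth by simp
    qed
  qed
  with m m3 that show ?thesis
    by blast
qed

section \<open>Zero-sum weightings of trees and odd-unicyclic graphs\<close>

locale zero_sum_weighting =
  fixes F :: "'v::finite \<Rightarrow> 'v \<Rightarrow> bool" and y :: "'v \<Rightarrow> 'v \<Rightarrow> real"
  assumes sym: "y i j = y j i"
    and diag_zero: "y i i = 0"
    and supported: "y i j \<noteq> 0 \<Longrightarrow> F i j"
    and row_sum_zero: "(\<Sum>j\<in>UNIV. y i j) = 0"
begin

abbreviation adj :: "'v \<Rightarrow> 'v \<Rightarrow> bool" where
  "adj i j \<equiv> y i j \<noteq> 0"

lemma adj_sym: "adj i j \<Longrightarrow> adj j i"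
  by (simp add: sym)

lemma other_neighbour:
  assumes "adj v a"
  obtains b where "b \<noteq> a" and "adj v b"
proof -
  have "\<exists>b. b \<noteq> a \<and> adj v b"
  proof (rule ccontr)
    assume "\<not> ?thesis"
    then have "(\<Sum>j\<in>UNIV. y v j) = (\<Sum>j\<in>UNIV. if j = a then y v a else 0)"
      by (intro sum.cong) auto
    with assms show False
      by (simp add: row_sum_zero)
  qed
  with that show ?thesis
    by blast
qed

lemma two_neighbours_cancel:
  assumes "a \<noteq> b" and "\<And>j. adj v j \<Longrightarrow> j = a \<or> j = b"
  shows "y v a + y v b = 0"
proof -
  have "(\<Sum>j\<in>UNIV. y v j) = (\<Sum>j\<in>UNIV. (if j = a then y v a else 0) + (if j = b then y v b else 0))"
    using assms by (intro sum.cong) auto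
  then show ?thesis
    by (simp add: sum.distrib row_sum_zero)
qed

lemma adj_cycle_is_cycle: "is_cycle adj cs \<Longrightarrow> is_cycle F cs"
  by (erule is_cycle_mono) (rule supported)

lemma path_in_component:
  assumes "is_path adj P"
  shows "set P \<subseteq> component F (hd P)"
proof
  fix x
  assume "x \<in> set P"
  with assms have "adj\<^sup>*\<^sup>* (hd P) x"
    by (auto simp: is_path_def intro: successively_rtranclp)
  then have "F\<^sup>*\<^sup>* (hd P) x"
    by (rule rtranclp_mono[THEN predicate2D, rotated]) (auto intro: supported)
  then show "x \<in> component F (hd P)"
    by (simp add: component_def)
qed

lemma path_last_other_neighbour:
  assumes "is_path adj P"
  obtains j where "adj (last P) j" and "j \<noteq> P ! (length P - 2)"
proof -
  have "adj (last P) (P ! (length P - 2))"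
    using adj_sym[OF is_path_last_adj[OF assms]] .
  then show ?thesis
    using that by (rule other_neighbour)
qed

lemma longest_path_cycle:
  assumes "longest_path adj P"
  obtains m where "m + 3 \<le> length P" and "is_cycle adj (drop m P)"
proof -
  obtain j where "adj (last P) j" "j \<noteq> P ! (length P - 2)"
    using assms path_last_other_neighbour by (auto simp: longest_path_def)
  then obtain m where "m + 3 \<le> length P" "is_cycle adj (drop m P)"
    using longest_path_last_cycle[OF assms] diag_zero by blast
  with that show ?thesis .
qed

lemma no_longest_path_in_tree:
  assumes "longest_path adj P" and "tree_component F C" and "set P \<subseteq> C"
  shows False
proof -
  obtain m where "is_cycle adj (drop m P)"
    using assms(1) by (rule longest_path_cycle)
  moreover have "set (drop m P) \<subseteq> C"
    using assms(3) set_drop_subset by fastforce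
  ultimately show False
    using assms(2) adj_cycle_is_cycle by (auto simp: tree_component_def)
qed

context
  fixes C :: "'v set"
  assumes unicyclic: "odd_unicyclic_component F C"
begin

lemma cycles_same_vertices:
  assumes "is_cycle F cs" "set cs \<subseteq> C" "is_cycle F ds" "set ds \<subseteq> C"
  shows "set cs = set ds"
proof -
  have "cycle_edges cs = cycle_edges ds"
    using unicyclic assms unfolding odd_unicyclic_component_def by blast
  moreover have "cs \<noteq> []" "ds \<noteq> []"
    using assms by (auto simp: is_cycle_def)
  ultimately show ?thesis
    by (metis Union_cycle_edges)
qed

text \<open>Both ends of a longest path close cycles, and these share their vertices, so the
  cycle through the last vertex already passes through the first one.\<close>

lemma longest_path_closes:
  assumes longest: "longest_path adj P" and "set P \<subseteq> C"
    and j: "adj (last P) j" "j \<noteq> P ! (length P - 2)"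
  shows "j = hd P" and "is_cycle adj P"
proof -
  obtain m where m: "m + 3 \<le> length P" "j = P ! m" and cyc: "is_cycle adj (drop m P)"
    using longest_path_last_cycle[OF longest _ j] diag_zero by blast
  have "longest_path adj (rev P)"
    using longest adj_sym by (rule longest_path_rev)
  then obtain m' where m': "m' + 3 \<le> length P" and cyc': "is_cycle adj (drop m' (rev P))"
    by (auto elim: longest_path_cycle)
  have "m' < length (rev P)"
    using m' by simp
  then have "hd P \<in> set (drop m' (rev P))"
    using last_in_set[of "drop m' (rev P)"] by (simp add: last_drop last_rev)
  moreover have "set (drop m' (rev P)) = set (drop m P)"
  proof (rule cycles_same_vertices)
    show "is_cycle F (drop m' (rev P))" "is_cycle F (drop m P)"
      using cyc cyc' by (auto intro: adj_cycle_is_cycle)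
    show "set (drop m' (rev P)) \<subseteq> C" "set (drop m P) \<subseteq> C"
      using \<open>set P \<subseteq> C\<close> set_drop_subset[of m' "rev P"] set_drop_subset[of m P] by auto
  qed
  ultimately have "hd P \<in> set (drop m P)"
    by simp
  moreover have "distinct P" "P \<noteq> []"
    using longest by (auto simp: longest_path_def is_path_def)
  ultimately obtain k where "k < length P - m" "P ! (m + k) = P ! 0"
    by (auto simp: in_set_conv_nth hd_conv_nth)
  with \<open>distinct P\<close> have "m = 0"
    by (subst (asm) nth_eq_iff_index_eq) auto
  with m cyc \<open>P \<noteq> []\<close> show "j = hd P" and "is_cycle adj P"
    by (auto simp: hd_conv_nth)
qed

lemma longest_path_hd_neighbours:
  assumes longest: "longest_path adj P" and "set P \<subseteq> C" and "adj (hd P) j"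
  shows "j = P ! 1 \<or> j = last P"
proof -
  have "2 \<le> length P" "P \<noteq> []"
    using longest by (auto simp: longest_path_def is_path_def)
  then have "rev P ! (length (rev P) - 2) = P ! 1"
    by (simp add: rev_nth)
  moreover have "longest_path adj (rev P)"
    using longest adj_sym by (rule longest_path_rev)
  ultimately show ?thesis
    using longest_path_closes(1)[of "rev P" j] assms \<open>P \<noteq> []\<close>
    by (auto simp: last_rev hd_rev)
qed

lemma longest_path_is_cycle:
  assumes "longest_path adj P" and "set P \<subseteq> C"
  shows "is_cycle adj P" and "adj (last P) (hd P)"
proof -
  obtain j where "adj (last P) j" "j \<noteq> P ! (length P - 2)"
    using assms path_last_other_neighbour by (auto simp: longest_path_def)
  with assms longest_path_closes show "is_cycle adj P" and "adj (last P) (hd P)"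
    by auto
qed

text \<open>The sign flips because the new first vertex has exactly two neighbours.\<close>

lemma longest_path_rotate1:
  assumes longest: "longest_path adj P" and "set P \<subseteq> C"
  shows "longest_path adj (rotate1 P)" and "y (hd (rotate1 P)) (rotate1 P ! 1) = - y (hd P) (P ! 1)"
proof -
  let ?R = "rotate1 P"
  show R: "longest_path adj ?R"
    using longest longest_path_is_cycle(2)[OF assms]
    by (auto simp: longest_path_def intro: is_path_rotate1)
  have "3 \<le> length P" "distinct P"
    using longest_path_is_cycle(1)[OF assms] by (auto simp: is_cycle_def)
  then obtain u v w Q where P: "P = u # v # w # Q"
    by (metis Suc_le_length_iff numeral_3_eq_3)
  then have "hd ?R = v" "?R ! 1 = w" "last ?R = u" and "w \<noteq> u"
    using \<open>distinct P\<close> by auto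
  moreover have "set ?R \<subseteq> C"
    using \<open>set P \<subseteq> C\<close> by simp
  ultimately have "y v w + y v u = 0"
    using longest_path_hd_neighbours[OF R] by (intro two_neighbours_cancel) auto
  then show "y (hd ?R) (?R ! 1) = - y (hd P) (P ! 1)"
    using P sym[of v u] by simp
qed

lemma no_longest_path_in_odd_unicyclic:
  assumes longest: "longest_path adj P" and "set P \<subseteq> C"
  shows False
proof -
  let ?e = "\<lambda>Q. y (hd Q) (Q ! 1)"
  have "longest_path adj (rotate k P) \<and> ?e (rotate k P) = (-1) ^ k * ?e P" for k
  proof (induction k)
    case (Suc k)
    then show ?case
      using longest_path_rotate1[of "rotate k P"] \<open>set P \<subseteq> C\<close> by simp
  qed (simp add: longest)
  then have "?e P = (-1) ^ length P * ?e P"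
    by (metis rotate_id mod_self)
  moreover have "odd (length P)"
    using unicyclic longest_path_is_cycle(1)[OF assms] adj_cycle_is_cycle \<open>set P \<subseteq> C\<close>
    by (auto simp: odd_unicyclic_component_def)
  ultimately have "?e P = 0"
    by simp
  moreover have "adj (P ! 0) (P ! 1)" "P \<noteq> []"
    using longest successively_nth[of adj P 0] by (auto simp: longest_path_def is_path_def)
  ultimately show False
    by (simp add: hd_conv_nth)
qed

end

theorem eq_0_if_trees_odd_unicyclic:
  assumes "trees_odd_unicyclic F"
  shows "y i j = 0"
proof (rule ccontr)
  assume "y i j \<noteq> 0"
  then have "is_path adj [i, j]"
    using diag_zero by (auto simp: is_path_def)
  then obtain P where longest: "longest_path adj P"
    by (rule longest_path_exists)
  let ?C = "component F (hd P)"
  have "set P \<subseteq> ?C"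
    using longest path_in_component by (simp add: longest_path_def)
  moreover have "tree_component F ?C \<or> odd_unicyclic_component F ?C"
    using assms by (simp add: trees_odd_unicyclic_def)
  ultimately show False
    using longest no_longest_path_in_tree no_longest_path_in_odd_unicyclic by blast
qed

end

section \<open>The SSP equations and principal submatrices\<close>

lemma symmetric_matrix_nth:
  assumes "transpose M = M"
  shows "M $ i $ j = M $ j $ i"
proof -
  have "transpose M $ j $ i = M $ j $ i"
    using assms by simp
  then show ?thesis
    by (simp add: transpose_def)
qed

lemma matrix_matrix_mult_nth: "(A ** B) $ i $ j = (\<Sum>k\<in>UNIV. A $ i $ k * B $ k $ j)"
  by (simp add: matrix_matrix_mult_def)

definition ssp_equations :: "real^'n^'n \<Rightarrow> real^'n^'n \<Rightarrow> bool" where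
  "ssp_equations A X \<longleftrightarrow> transpose X = X \<and> (\<forall>i j. A $ i $ j * X $ i $ j = 0) \<and>
     (\<forall>i. X $ i $ i = 0) \<and> A ** X - X ** A = 0"

lemma SSP_iff_ssp_equations: "SSP A \<longleftrightarrow> (\<forall>X. ssp_equations A X \<longrightarrow> X = 0)"
  by (simp add: SSP_def ssp_equations_def)

lemma ssp_equations_support:
  assumes "A \<in> S_graph E" and "ssp_equations A X" and "X $ i $ j \<noteq> 0"
  shows "graph_complement E i j"
proof -
  have "i \<noteq> j" and "A $ i $ j = 0"
    using assms(2,3) by (auto simp: ssp_equations_def)
  with assms(1) show ?thesis
    unfolding S_graph_def graph_complement_def by blast
qed

definition submatrix :: "('m \<Rightarrow> 'n) \<Rightarrow> 'a^'n^'n \<Rightarrow> 'a^'m^'m" where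
  "submatrix f M = (\<chi> i j. M $ f i $ f j)"

lemma submatrix_nth [simp]: "submatrix f M $ i $ j = M $ f i $ f j"
  by (simp add: submatrix_def)

lemma transpose_submatrix: "transpose (submatrix f M) = submatrix f (transpose M)"
  by (simp add: vec_eq_iff transpose_def)

lemma submatrix_S_graph:
  assumes "A \<in> S_graph E" and "inj f"
  shows "submatrix f A \<in> S_graph (\<lambda>i j. E (f i) (f j))"
  using assms by (auto simp: S_graph_def transpose_submatrix inj_eq)

lemma sum_reindex_range:
  fixes g :: "'n::finite \<Rightarrow> 'a::comm_monoid_add"
  assumes "inj f" and "\<And>k. k \<notin> range f \<Longrightarrow> g k = 0"
  shows "(\<Sum>k\<in>UNIV. g (f k)) = (\<Sum>k\<in>UNIV. g k)"
proof -
  have "(\<Sum>k\<in>UNIV. g (f k)) = sum g (range f)"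
    using assms(1) by (simp add: sum.reindex)
  also have "\<dots> = sum g UNIV"
    using assms(2) by (intro sum.mono_neutral_left) auto
  finally show ?thesis .
qed

lemma ssp_equations_submatrix:
  assumes "inj f" and X: "ssp_equations A X"
    and outside: "\<And>i k. k \<notin> range f \<Longrightarrow> X $ f i $ k = 0"
  shows "ssp_equations (submatrix f A) (submatrix f X)"
proof -
  have sym: "transpose X = X"
    using X by (simp add: ssp_equations_def)
  have "(submatrix f A ** submatrix f X) $ i $ j = (submatrix f X ** submatrix f A) $ i $ j" for i j
  proof -
    have "(submatrix f A ** submatrix f X) $ i $ j = (A ** X) $ f i $ f j"
      unfolding matrix_matrix_mult_nth submatrix_nth
      using outside symmetric_matrix_nth[OF sym] by (intro sum_reindex_range[OF \<open>inj f\<close>]) auto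
    also have "\<dots> = (X ** A) $ f i $ f j"
      using X by (simp add: ssp_equations_def)
    also have "\<dots> = (submatrix f X ** submatrix f A) $ i $ j"
      unfolding matrix_matrix_mult_nth submatrix_nth
      using outside by (intro sum_reindex_range[OF \<open>inj f\<close>, symmetric]) auto
    finally show ?thesis .
  qed
  with X show ?thesis
    by (simp add: ssp_equations_def vec_eq_iff transpose_submatrix)
qed

lemma submatrix_eq_0_if_GSSP:
  assumes "inj f" and "GSSP (\<lambda>i j. E (f i) (f j))" and "A \<in> S_graph E" and "ssp_equations A X"
    and "\<And>i k. k \<notin> range f \<Longrightarrow> X $ f i $ k = 0"
  shows "submatrix f X = 0"
proof -
  have "submatrix f A \<in> S_graph (\<lambda>i j. E (f i) (f j))"
    using assms(3,1) by (rule submatrix_S_graph)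
  moreover have "ssp_equations (submatrix f A) (submatrix f X)"
    using assms(1,4,5) by (rule ssp_equations_submatrix)
  ultimately show ?thesis
    using assms(2) by (simp add: GSSP_def SSP_iff_ssp_equations)
qed

lemma commute_zero_row:
  assumes "A ** X = X ** A" and "X $ r = 0"
  shows "(A ** X) $ r = 0"
  using assms(2) by (simp add: assms(1) vec_eq_iff matrix_matrix_mult_nth)

lemma eq_0_if_nowhere_zero_left_null_vector:
  fixes X :: "real^'n^'n" and w :: "'n \<Rightarrow> real"
  assumes "trees_odd_unicyclic F" and "transpose X = X" and "\<And>i. X $ i $ i = 0"
    and "\<And>i j. X $ i $ j \<noteq> 0 \<Longrightarrow> F i j"
    and "\<And>k. w k \<noteq> 0" and null: "\<And>j. (\<Sum>k\<in>UNIV. w k * X $ k $ j) = 0"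
  shows "X = 0"
proof -
  define y where "y i j = w i * X $ i $ j * w j" for i j
  interpret zero_sum_weighting F y
  proof
    show "y i j = y j i" for i j
      using symmetric_matrix_nth[OF assms(2)] by (simp add: y_def)
    show "y i i = 0" for i
      using assms(3) by (simp add: y_def)
    show "y i j \<noteq> 0 \<Longrightarrow> F i j" for i j
      using assms(4) by (simp add: y_def)
    show "(\<Sum>j\<in>UNIV. y i j) = 0" for i
    proof -
      have "(\<Sum>j\<in>UNIV. y i j) = w i * (\<Sum>j\<in>UNIV. w j * X $ j $ i)"
        using symmetric_matrix_nth[OF assms(2)] by (simp add: y_def sum_distrib_left mult_ac)
      then show ?thesis
        using null by simp
    qed
  qed
  have "X $ i $ j = 0" for i j
    using eq_0_if_trees_odd_unicyclic[OF assms(1), of i j] assms(5) by (simp add: y_def)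
  then show ?thesis
    by (simp add: vec_eq_iff)
qed

section \<open>Joins\<close>

lemma sum_UNIV_sum:
  fixes g :: "'a::finite + 'b::finite \<Rightarrow> 'c::comm_monoid_add"
  shows "(\<Sum>k\<in>UNIV. g k) = (\<Sum>a\<in>UNIV. g (Inl a)) + (\<Sum>b\<in>UNIV. g (Inr b))"
proof -
  have "sum g (UNIV <+> UNIV) = sum (g \<circ> Inl) UNIV + sum (g \<circ> Inr) UNIV"
    by (rule sum.Plus) simp_all
  then show ?thesis
    by simp
qed

lemma matrix_eq_0_iff_blocks:
  fixes X :: "'c::zero^('a::finite + 'b::finite)^('a + 'b)"
  shows "X = 0 \<longleftrightarrow> submatrix Inl X = 0 \<and> submatrix Inr X = 0 \<and>
    (\<forall>a b. X $ Inl a $ Inr b = 0 \<and> X $ Inr b $ Inl a = 0)"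
  by (auto simp: vec_eq_iff) (metis sum.exhaust)+

lemma ssp_equations_join_cross:
  assumes "A \<in> S_graph (graph_join G H)" and "ssp_equations A X"
  shows "X $ Inl a $ Inr b = 0" and "X $ Inr b $ Inl a = 0"
  using ssp_equations_support[OF assms, of "Inl a" "Inr b"]
    ssp_equations_support[OF assms, of "Inr b" "Inl a"]
  by (auto simp: graph_complement_def)

lemma ssp_equations_join_outside:
  assumes "A \<in> S_graph (graph_join G H)" and "ssp_equations A X"
  shows "k \<notin> range Inl \<Longrightarrow> X $ Inl a $ k = 0" and "k \<notin> range Inr \<Longrightarrow> X $ Inr b $ k = 0"
  using ssp_equations_join_cross[OF assms] by (cases k; auto)+

lemma join_Inl_block_eq_0:
  assumes "GSSP G" and "A \<in> S_graph (graph_join G H)" and "ssp_equations A X"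
  shows "submatrix Inl X = 0"
  using assms ssp_equations_join_outside[OF assms(2,3)]
  by (intro submatrix_eq_0_if_GSSP[where E = "graph_join G H"]) auto

lemma join_Inr_block_eq_0:
  assumes "GSSP H" and "A \<in> S_graph (graph_join G H)" and "ssp_equations A X"
  shows "submatrix Inr X = 0"
  using assms ssp_equations_join_outside[OF assms(2,3)]
  by (intro submatrix_eq_0_if_GSSP[where E = "graph_join G H"]) auto

lemma join_Inr_block_eq_0_if_complement:
  fixes G :: "'a::finite \<Rightarrow> 'a \<Rightarrow> bool" and H :: "'b::finite \<Rightarrow> 'b \<Rightarrow> bool"
  assumes "trees_odd_unicyclic (graph_complement H)" and A: "A \<in> S_graph (graph_join G H)"
    and X: "ssp_equations A X" and "submatrix Inl X = 0"
  shows "submatrix Inr X = 0"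
proof -
  fix a :: 'a
  have cross: "X $ Inl a' $ Inr b = 0" for a' b
    using ssp_equations_join_cross(1)[OF A X] .
  have "X $ Inl a = 0"
    using \<open>submatrix Inl X = 0\<close> cross
    by (auto simp: vec_eq_iff) (metis sum.exhaust submatrix_nth zero_index)
  moreover have "A ** X = X ** A"
    using X by (simp add: ssp_equations_def)
  ultimately have "(A ** X) $ Inl a = 0"
    by (intro commute_zero_row)
  then have "(A ** X) $ Inl a $ Inr j = 0" for j
    by simp
  then have null: "(\<Sum>k\<in>UNIV. A $ Inl a $ Inr k * submatrix Inr X $ k $ j) = 0" for j
    by (simp add: matrix_matrix_mult_nth sum_UNIV_sum cross)
  have X2: "ssp_equations (submatrix Inr A) (submatrix Inr X)"
    using X ssp_equations_join_outside(2)[OF A X]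
    by (intro ssp_equations_submatrix) (auto simp: inj_on_def)
  have A2: "submatrix Inr A \<in> S_graph H"
    using submatrix_S_graph[OF A, of Inr] by (simp add: inj_on_def)
  show ?thesis
  proof (rule eq_0_if_nowhere_zero_left_null_vector[OF assms(1) _ _ _ _ null])
    show "transpose (submatrix Inr X) = submatrix Inr X" "submatrix Inr X $ i $ i = 0" for i
      using X2 by (simp_all add: ssp_equations_def)
    show "graph_complement H i j" if "submatrix Inr X $ i $ j \<noteq> 0" for i j
      using ssp_equations_support[OF A2 X2 that] .
    show "A $ Inl a $ Inr k \<noteq> 0" for k
      using A by (simp add: S_graph_def)
  qed
qed

theorem corollary5p2:
  fixes G :: "'a::finite \<Rightarrow> 'a \<Rightarrow> bool" and H :: "'b::finite \<Rightarrow> 'b \<Rightarrow> bool"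
  assumes "sgraph G" and "sgraph H"
    and "GSSP G"
    and "\<exists>x y. G x y"
    and "GSSP H \<or> trees_odd_unicyclic (graph_complement H)"
  shows "GSSP (graph_join G H)"
  unfolding GSSP_def SSP_iff_ssp_equations
proof (intro ballI allI impI)
  fix A X
  assume A: "A \<in> S_graph (graph_join G H)" and X: "ssp_equations A X"
  have upper: "submatrix Inl X = 0"
    using assms(3) A X by (rule join_Inl_block_eq_0)
  have lower: "submatrix Inr X = 0"
    using assms(5)
  proof
    assume "GSSP H"
    then show ?thesis
      using A X by (rule join_Inr_block_eq_0)
  next
    assume "trees_odd_unicyclic (graph_complement H)"
    then show ?thesis
      using A X upper by (rule join_Inr_block_eq_0_if_complement)
  qed
  show "X = 0"
    using upper lower ssp_equations_join_cross[OF A X] by (simp add: matrix_eq_0_iff_blocks)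
qed

end
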